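(* Fix a mode theory $\mathcal{M}$ (a strict 2-category) and consider the multimodal natural deduction system described in the context. The following lock-weakening rule is admissible: for all pre-contexts $\Gamma,\Delta$, parallel modalities $\mu,\nu : n \to m$, transformation $\alpha : \mu\Rightarrow\nu$, mode $p$ and formula $\varphi$, if $\Gamma.\mathsf{lock}_\mu, \Delta \vdash \varphi\ @\,p$ is derivable, then $\Gamma.\mathsf{lock}_\nu, \Delta \vdash \varphi\ @\,p$ is derivable.
   Context: A mode theory is a strict 2-category $\mathcal{M}$. Its objects are called modes ($m,n,o,p,\dots$); its 1-cells $\mu : n \to m$ are called modalities, with composition $\mu\circ\nu : o \to m$ for $\nu : o\to n$, $\mu : n \to m$, and identities $1_m : m \to m$; its 2-cells $\alpha : \mu \Rightarrow \nu$ (between parallel modalities) are called transformations, with vertical composition $\beta\circ\alpha$, identities $1_\mu$, and horizontal composition $\alpha * \beta : \mu\circ\theta \Rightarrow \nu\circ\xi$ for $\alpha:\mu\Rightarrow\nu$, $\beta : \theta\Rightarrow\xi$, satisfying the strict 2-category laws. Formulas. Pre-formulas: $\varphi,\psi ::= p_i \mid \bot \mid \top \mid \varphi\lor\psi \mid \varphi\land\psi \mid (\mu\mid\varphi)\to\psi \mid \langle\mu\mid\varphi\rangle$. The judgement "$\varphi$ wff $@\,m$" is generated by: $p_i,\top,\bot$ are wff at every mode; if $\varphi,\psi$ wff $@\,m$ then so are $\varphi\land\psi$, $\varphi\lor\psi$; if $\mu:n\to m$, $\varphi$ wff $@\,n$ and $\psi$ wff $@\,m$ then $(\mu\mid\varphi)\to\psi$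 wff $@\,m$; if $\varphi$ wff $@\,n$ and $\mu:n\to m$ then $\langle\mu\mid\varphi\rangle$ wff $@\,m$. Contexts. Pre-contexts: $\Gamma ::= \cdot \mid \Gamma, (\mu\mid\varphi) \mid \Gamma.\mathsf{lock}_\mu$. The judgement "$\Gamma$ ctx $@\,m$" is generated by: $\cdot$ ctx $@\,m$; if $\Gamma$ ctx $@\,m$, $\mu : n\to m$ and $\varphi$ wff $@\,n$ then $\Gamma,(\mu\mid\varphi)$ ctx $@\,m$; if $\Gamma$ ctx $@\,m$ and $\mu : n \to m$ then $\Gamma.\mathsf{lock}_\mu$ ctx $@\,n$. Contexts are identified modulo $\Gamma.\mathsf{lock}_{1_m} = \Gamma$ and $\Gamma.\mathsf{lock}_\mu.\mathsf{lock}_\nu = \Gamma.\mathsf{lock}_{\mu\circ\nu}$. $\Gamma,\Delta$ denotes concatenation of pre-contexts. Define $|\cdot| = 1$, $|\Gamma,(\mu\mid\varphi)| = |\Gamma|$, $|\Gamma.\mathsf{lock}_\mu| = |\Gamma|\circ\mu$. Derivability of $\Gamma\vdash\varphi\ @\,m$ is generated by the rules: (var) if $\mu : n\to m$ and $\alpha : \mu\Rightarrow |\Delta|$ then $\Gamma,(\mu\mid\varphi),\Delta \vdash \varphi\ @\,n$; ($\top$) $\Gamma\vdash\top\ @\,m$; ($\bot$E) from $\Gamma\vdash\bot\ @\,m$ infer $\Gamma\vdash\varphi\ @\,m$; ($\land$I) from $\Gamma\vdash\varphi$ and $\Gamma\vdash\psi$ infer $\Gamma\vdash\varphi\land\psi$;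 ($\land$E) from $\Gamma\vdash\varphi_1\land\varphi_2$ infer $\Gamma\vdash\varphi_i$; ($\lor$I) from $\Gamma\vdash\varphi_i$ infer $\Gamma\vdash\varphi_1\lor\varphi_2$; ($\lor$E) from $\Gamma\vdash\varphi\lor\psi$, $\Gamma,(1\mid\varphi)\vdash C$, $\Gamma,(1\mid\psi)\vdash C$ infer $\Gamma\vdash C$ (all at the same mode); ($\to$I) from $\Gamma,(\mu\mid\varphi)\vdash\psi\ @\,m$ infer $\Gamma\vdash(\mu\mid\varphi)\to\psi\ @\,m$; ($\to$E) if $\mu:n\to m$, from $\Gamma\vdash(\mu\mid\varphi)\to\psi\ @\,m$ and $\Gamma.\mathsf{lock}_\mu\vdash\varphi\ @\,n$ infer $\Gamma\vdash\psi\ @\,m$; (modI) if $\mu:n\to m$, from $\Gamma.\mathsf{lock}_\mu\vdash\varphi\ @\,n$ infer $\Gamma\vdash\langle\mu\mid\varphi\rangle\ @\,m$; (modE) if $\nu:o\to n$, $\mu:n\to m$, from $\Gamma.\mathsf{lock}_\mu\vdash\langle\nu\mid\varphi\rangle\ @\,n$ and $\Gamma,(\mu\circ\nu\mid\varphi)\vdash\psi\ @\,m$ infer $\Gamma\vdash\psi\ @\,m$. A rule is admissible if whenever its premises are derivable, so is its conclusion. *)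

theory Defs
  imports Main
begin

record ('o, 'm, 't) mode_theory =
  modes :: "'o set"
  modalities :: "'m set"
  transformations :: "'t set"
  src :: "'m \<Rightarrow> 'o"
  tgt :: "'m \<Rightarrow> 'o"
  one :: "'o \<Rightarrow> 'm" ("\<one>\<index>")
  comp1 :: "'m \<Rightarrow> 'm \<Rightarrow> 'm" (infixl "\<odot>\<index>" 70)
  src2 :: "'t \<Rightarrow> 'm"
  tgt2 :: "'t \<Rightarrow> 'm"
  one2 :: "'m \<Rightarrow> 't"
  vcomp :: "'t \<Rightarrow> 't \<Rightarrow> 't" (infixl "\<cdot>\<index>" 70)
  hcomp :: "'t \<Rightarrow> 't \<Rightarrow> 't" (infixl "\<star>\<index>" 75)

definition modality :: "('o, 'm, 't, 'x) mode_theory_scheme \<Rightarrow> 'm \<Rightarrow> 'o \<Rightarrow> 'o \<Rightarrow> bool" where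
  "modality M \<mu> n m \<longleftrightarrow> \<mu> \<in> modalities M \<and> src M \<mu> = n \<and> tgt M \<mu> = m"

definition transformation :: "('o, 'm, 't, 'x) mode_theory_scheme \<Rightarrow> 't \<Rightarrow> 'm \<Rightarrow> 'm \<Rightarrow> bool" where
  "transformation M \<alpha> \<mu> \<nu> \<longleftrightarrow> \<alpha> \<in> transformations M \<and> src2 M \<alpha> = \<mu> \<and> tgt2 M \<alpha> = \<nu>"

text \<open>Both \<open>\<mu> \<odot> \<nu>\<close> and \<open>\<beta> \<cdot> \<alpha>\<close> are written in applicative order: the right argument comes first.\<close>

locale strict_two_category =
  fixes M :: "('o, 'm, 't, 'x) mode_theory_scheme" (structure)
  assumes modality_modes: "modality M \<mu> n m \<Longrightarrow> n \<in> modes M \<and> m \<in> modes M"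
    and one_modality: "m \<in> modes M \<Longrightarrow> modality M (\<one> m) m m"
    and comp1_modality:
      "\<lbrakk>modality M \<mu> n m; modality M \<nu> o' n\<rbrakk> \<Longrightarrow> modality M (\<mu> \<odot> \<nu>) o' m"
    and comp1_one_left: "modality M \<mu> n m \<Longrightarrow> \<one> m \<odot> \<mu> = \<mu>"
    and comp1_one_right: "modality M \<mu> n m \<Longrightarrow> \<mu> \<odot> \<one> n = \<mu>"
    and comp1_assoc:
      "\<lbrakk>modality M \<mu> n m; modality M \<nu> o' n; modality M \<xi> p o'\<rbrakk>
        \<Longrightarrow> (\<mu> \<odot> \<nu>) \<odot> \<xi> = \<mu> \<odot> (\<nu> \<odot> \<xi>)"
    and transformation_parallel:
      "transformation M \<alpha> \<mu> \<nu> \<Longrightarrow> \<exists>n m. modality M \<mu> n m \<and> modality M \<nu> n m"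
    and one2_transformation: "modality M \<mu> n m \<Longrightarrow> transformation M (one2 M \<mu>) \<mu> \<mu>"
    and vcomp_transformation:
      "\<lbrakk>transformation M \<alpha> \<mu> \<nu>; transformation M \<beta> \<nu> \<xi>\<rbrakk>
        \<Longrightarrow> transformation M (\<beta> \<cdot> \<alpha>) \<mu> \<xi>"
    and vcomp_one_left: "transformation M \<alpha> \<mu> \<nu> \<Longrightarrow> one2 M \<nu> \<cdot> \<alpha> = \<alpha>"
    and vcomp_one_right: "transformation M \<alpha> \<mu> \<nu> \<Longrightarrow> \<alpha> \<cdot> one2 M \<mu> = \<alpha>"
    and vcomp_assoc:
      "\<lbrakk>transformation M \<alpha> \<mu> \<nu>; transformation M \<beta> \<nu> \<xi>; transformation M \<gamma> \<xi> \<zeta>\<rbrakk>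
        \<Longrightarrow> (\<gamma> \<cdot> \<beta>) \<cdot> \<alpha> = \<gamma> \<cdot> (\<beta> \<cdot> \<alpha>)"
    and hcomp_transformation:
      "\<lbrakk>transformation M \<alpha> \<mu> \<nu>; transformation M \<beta> \<theta> \<xi>; modality M \<mu> n m; modality M \<theta> o' n\<rbrakk>
        \<Longrightarrow> transformation M (\<alpha> \<star> \<beta>) (\<mu> \<odot> \<theta>) (\<nu> \<odot> \<xi>)"
    and hcomp_one_left:
      "\<lbrakk>transformation M \<alpha> \<mu> \<nu>; modality M \<mu> n m\<rbrakk> \<Longrightarrow> one2 M (\<one> m) \<star> \<alpha> = \<alpha>"
    and hcomp_one_right:
      "\<lbrakk>transformation M \<alpha> \<mu> \<nu>; modality M \<mu> n m\<rbrakk> \<Longrightarrow> \<alpha> \<star> one2 M (\<one> n) = \<alpha>"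
    and hcomp_assoc:
      "\<lbrakk>transformation M \<alpha> \<mu> \<mu>'; transformation M \<beta> \<nu> \<nu>'; transformation M \<gamma> \<xi> \<xi>';
        modality M \<mu> n m; modality M \<nu> o' n; modality M \<xi> p o'\<rbrakk>
        \<Longrightarrow> (\<alpha> \<star> \<beta>) \<star> \<gamma> = \<alpha> \<star> (\<beta> \<star> \<gamma>)"
    and hcomp_one2:
      "\<lbrakk>modality M \<mu> n m; modality M \<nu> o' n\<rbrakk>
        \<Longrightarrow> one2 M \<mu> \<star> one2 M \<nu> = one2 M (\<mu> \<odot> \<nu>)"
    and interchange:
      "\<lbrakk>transformation M \<alpha> \<mu> \<mu>'; transformation M \<beta> \<mu>' \<mu>'';
        transformation M \<gamma> \<nu> \<nu>'; transformation M \<delta> \<nu>' \<nu>'';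
        modality M \<mu> n m; modality M \<nu> o' n\<rbrakk>
        \<Longrightarrow> (\<beta> \<cdot> \<alpha>) \<star> (\<delta> \<cdot> \<gamma>) = (\<beta> \<star> \<delta>) \<cdot> (\<alpha> \<star> \<gamma>)"

datatype 'm form =
    Var nat
  | Bot
  | Top
  | Or "'m form" "'m form"
  | And "'m form" "'m form"
  | Imp 'm "'m form" "'m form" \<comment> \<open>\<open>Imp \<mu> \<phi> \<psi>\<close> is \<open>(\<mu> | \<phi>) \<rightarrow> \<psi>\<close>\<close>
  | Mod 'm "'m form"

inductive wff :: "('o, 'm, 't, 'x) mode_theory_scheme \<Rightarrow> 'm form \<Rightarrow> 'o \<Rightarrow> bool"
  for M (structure) where
  wff_Var: "m \<in> modes M \<Longrightarrow> wff M (Var i) m"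
| wff_Bot: "m \<in> modes M \<Longrightarrow> wff M Bot m"
| wff_Top: "m \<in> modes M \<Longrightarrow> wff M Top m"
| wff_Or: "\<lbrakk>wff M \<phi> m; wff M \<psi> m\<rbrakk> \<Longrightarrow> wff M (Or \<phi> \<psi>) m"
| wff_And: "\<lbrakk>wff M \<phi> m; wff M \<psi> m\<rbrakk> \<Longrightarrow> wff M (And \<phi> \<psi>) m"
| wff_Imp: "\<lbrakk>modality M \<mu> n m; wff M \<phi> n; wff M \<psi> m\<rbrakk> \<Longrightarrow> wff M (Imp \<mu> \<phi> \<psi>) m"
| wff_Mod: "\<lbrakk>wff M \<phi> n; modality M \<mu> n m\<rbrakk> \<Longrightarrow> wff M (Mod \<mu> \<phi>) m"

datatype 'm prectx =
    Emp
  | Ext "'m prectx" 'm "'m form"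
  | Lock "'m prectx" 'm

primrec cat :: "'m prectx \<Rightarrow> 'm prectx \<Rightarrow> 'm prectx" where
  "cat \<Gamma> Emp = \<Gamma>"
| "cat \<Gamma> (Ext \<Delta> \<mu> \<phi>) = Ext (cat \<Gamma> \<Delta>) \<mu> \<phi>"
| "cat \<Gamma> (Lock \<Delta> \<mu>) = Lock (cat \<Gamma> \<Delta>) \<mu>"

inductive ctx :: "('o, 'm, 't, 'x) mode_theory_scheme \<Rightarrow> 'm prectx \<Rightarrow> 'o \<Rightarrow> bool"
  for M (structure) where
  ctx_Emp: "m \<in> modes M \<Longrightarrow> ctx M Emp m"
| ctx_Ext: "\<lbrakk>ctx M \<Gamma> m; modality M \<mu> n m; wff M \<phi> n\<rbrakk> \<Longrightarrow> ctx M (Ext \<Gamma> \<mu> \<phi>) m"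
| ctx_Lock: "\<lbrakk>ctx M \<Gamma> m; modality M \<mu> n m\<rbrakk> \<Longrightarrow> ctx M (Lock \<Gamma> \<mu>) n"

text \<open>
  The empty pre-context exists at every mode, so \<open>|\<Delta>|\<close> is relative to the mode \<open>m\<close> at which
  \<open>\<Delta>\<close> starts: \<open>locks M m \<Delta>\<close> is a modality into \<open>m\<close>.
\<close>

primrec locks :: "('o, 'm, 't, 'x) mode_theory_scheme \<Rightarrow> 'o \<Rightarrow> 'm prectx \<Rightarrow> 'm" where
  "locks M m Emp = \<one>\<^bsub>M\<^esub> m"
| "locks M m (Ext \<Gamma> \<mu> \<phi>) = locks M m \<Gamma>"
| "locks M m (Lock \<Gamma> \<mu>) = locks M m \<Gamma> \<odot>\<^bsub>M\<^esub> \<mu>"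

text \<open>
  The identification of contexts is the congruence generated by the two lock equations. It relates
  contexts at a common mode, so that \<open>Lock \<Gamma> (\<one> m)\<close> is equated with \<open>\<Gamma>\<close> only when \<open>\<Gamma>\<close>
  lives at \<open>m\<close>.
\<close>

inductive ctx_eq ::
  "('o, 'm, 't, 'x) mode_theory_scheme \<Rightarrow> 'm prectx \<Rightarrow> 'm prectx \<Rightarrow> 'o \<Rightarrow> bool"
  for M (structure) where
  ctx_eq_refl: "ctx M \<Gamma> m \<Longrightarrow> ctx_eq M \<Gamma> \<Gamma> m"
| ctx_eq_sym: "ctx_eq M \<Gamma> \<Delta> m \<Longrightarrow> ctx_eq M \<Delta> \<Gamma> m"
| ctx_eq_trans: "\<lbrakk>ctx_eq M \<Gamma> \<Delta> m; ctx_eq M \<Delta> \<Theta> m\<rbrakk> \<Longrightarrow> ctx_eq M \<Gamma> \<Theta> m"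
| ctx_eq_Ext:
    "\<lbrakk>ctx_eq M \<Gamma> \<Delta> m; modality M \<mu> n m; wff M \<phi> n\<rbrakk>
      \<Longrightarrow> ctx_eq M (Ext \<Gamma> \<mu> \<phi>) (Ext \<Delta> \<mu> \<phi>) m"
| ctx_eq_Lock:
    "\<lbrakk>ctx_eq M \<Gamma> \<Delta> m; modality M \<mu> n m\<rbrakk> \<Longrightarrow> ctx_eq M (Lock \<Gamma> \<mu>) (Lock \<Delta> \<mu>) n"
| ctx_eq_Lock_one: "ctx M \<Gamma> m \<Longrightarrow> ctx_eq M (Lock \<Gamma> (\<one> m)) \<Gamma> m"
| ctx_eq_Lock_comp:
    "\<lbrakk>ctx M \<Gamma> m; modality M \<mu> n m; modality M \<nu> o' n\<rbrakk>
      \<Longrightarrow> ctx_eq M (Lock (Lock \<Gamma> \<mu>) \<nu>) (Lock \<Gamma> (\<mu> \<odot> \<nu>)) o'"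

text \<open>
  Rule \<open>conv\<close> expresses that derivability is a property of contexts up to \<open>ctx_eq\<close>. The premises
  \<open>ctx\<close> and \<open>wff\<close> are the presuppositions of the judgement; they are stated only where they
  do not already follow from the other premises.
\<close>

inductive derivable ::
  "('o, 'm, 't, 'x) mode_theory_scheme \<Rightarrow> 'm prectx \<Rightarrow> 'm form \<Rightarrow> 'o \<Rightarrow> bool"
  for M (structure) where
  conv: "\<lbrakk>ctx_eq M \<Gamma> \<Delta> m; derivable M \<Gamma> \<phi> m\<rbrakk> \<Longrightarrow> derivable M \<Delta> \<phi> m"
| var:
    "\<lbrakk>ctx M (cat (Ext \<Gamma> \<mu> \<phi>) \<Delta>) n; modality M \<mu> n m; transformation M \<alpha> \<mu> (locks M m \<Delta>)\<rbrakk>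
      \<Longrightarrow> derivable M (cat (Ext \<Gamma> \<mu> \<phi>) \<Delta>) \<phi> n"
| TopI: "ctx M \<Gamma> m \<Longrightarrow> derivable M \<Gamma> Top m"
| BotE: "\<lbrakk>derivable M \<Gamma> Bot m; wff M \<phi> m\<rbrakk> \<Longrightarrow> derivable M \<Gamma> \<phi> m"
| AndI: "\<lbrakk>derivable M \<Gamma> \<phi> m; derivable M \<Gamma> \<psi> m\<rbrakk> \<Longrightarrow> derivable M \<Gamma> (And \<phi> \<psi>) m"
| AndE1: "derivable M \<Gamma> (And \<phi> \<psi>) m \<Longrightarrow> derivable M \<Gamma> \<phi> m"
| AndE2: "derivable M \<Gamma> (And \<phi> \<psi>) m \<Longrightarrow> derivable M \<Gamma> \<psi> m"
| OrI1: "\<lbrakk>derivable M \<Gamma> \<phi> m; wff M \<psi> m\<rbrakk> \<Longrightarrow> derivable M \<Gamma> (Or \<phi> \<psi>) m"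
| OrI2: "\<lbrakk>derivable M \<Gamma> \<psi> m; wff M \<phi> m\<rbrakk> \<Longrightarrow> derivable M \<Gamma> (Or \<phi> \<psi>) m"
| OrE:
    "\<lbrakk>derivable M \<Gamma> (Or \<phi> \<psi>) m; derivable M (Ext \<Gamma> (\<one> m) \<phi>) \<chi> m;
      derivable M (Ext \<Gamma> (\<one> m) \<psi>) \<chi> m\<rbrakk> \<Longrightarrow> derivable M \<Gamma> \<chi> m"
| ImpI: "derivable M (Ext \<Gamma> \<mu> \<phi>) \<psi> m \<Longrightarrow> derivable M \<Gamma> (Imp \<mu> \<phi> \<psi>) m"
| ImpE:
    "\<lbrakk>modality M \<mu> n m; derivable M \<Gamma> (Imp \<mu> \<phi> \<psi>) m; derivable M (Lock \<Gamma> \<mu>) \<phi> n\<rbrakk>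
      \<Longrightarrow> derivable M \<Gamma> \<psi> m"
| ModI:
    "\<lbrakk>modality M \<mu> n m; derivable M (Lock \<Gamma> \<mu>) \<phi> n\<rbrakk> \<Longrightarrow> derivable M \<Gamma> (Mod \<mu> \<phi>) m"
| ModE:
    "\<lbrakk>modality M \<nu> o' n; modality M \<mu> n m; derivable M (Lock \<Gamma> \<mu>) (Mod \<nu> \<phi>) n;
      derivable M (Ext \<Gamma> (\<mu> \<odot> \<nu>) \<phi>) \<psi> m\<rbrakk> \<Longrightarrow> derivable M \<Gamma> \<psi> m"

end

theory Submission
  imports Defs
begin

text \<open>
  Lock weakening generates a preorder on contexts which contains \<open>ctx_eq\<close> and is preserved by
  extensions and locks; derivability is monotone for it, by induction on derivations. Only the
  variable rule needs an argument: passing to a larger context keeps every hypothesis and changes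
  the composite \<open>\<kappa>\<close> of the locks to its right along a transformation \<open>\<kappa> \<Rightarrow> \<kappa>'\<close>, obtained by
  whiskering, with which the transformation required by the rule is composed.
\<close>

inductive ctx_le ::
  "('o, 'm, 't, 'x) mode_theory_scheme \<Rightarrow> 'm prectx \<Rightarrow> 'm prectx \<Rightarrow> 'o \<Rightarrow> bool"
  for M (structure) where
  ctx_le_refl: "ctx M \<Gamma> m \<Longrightarrow> ctx_le M \<Gamma> \<Gamma> m"
| ctx_le_trans: "\<lbrakk>ctx_le M \<Gamma> \<Delta> m; ctx_le M \<Delta> \<Theta> m\<rbrakk> \<Longrightarrow> ctx_le M \<Gamma> \<Theta> m"
| ctx_le_Ext:
    "\<lbrakk>ctx_le M \<Gamma> \<Delta> m; modality M \<mu> n m; wff M \<phi> n\<rbrakk>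
      \<Longrightarrow> ctx_le M (Ext \<Gamma> \<mu> \<phi>) (Ext \<Delta> \<mu> \<phi>) m"
| ctx_le_Lock:
    "\<lbrakk>ctx_le M \<Gamma> \<Delta> m; modality M \<mu> n m\<rbrakk> \<Longrightarrow> ctx_le M (Lock \<Gamma> \<mu>) (Lock \<Delta> \<mu>) n"
| ctx_le_Lock_oneD: "ctx M \<Gamma> m \<Longrightarrow> ctx_le M (Lock \<Gamma> (\<one> m)) \<Gamma> m"
| ctx_le_Lock_oneI: "ctx M \<Gamma> m \<Longrightarrow> ctx_le M \<Gamma> (Lock \<Gamma> (\<one> m)) m"
| ctx_le_Lock_compI:
    "\<lbrakk>ctx M \<Gamma> m; modality M \<mu> n m; modality M \<nu> o' n\<rbrakk>
      \<Longrightarrow> ctx_le M (Lock (Lock \<Gamma> \<mu>) \<nu>) (Lock \<Gamma> (\<mu> \<odot> \<nu>)) o'"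
| ctx_le_Lock_compD:
    "\<lbrakk>ctx M \<Gamma> m; modality M \<mu> n m; modality M \<nu> o' n\<rbrakk>
      \<Longrightarrow> ctx_le M (Lock \<Gamma> (\<mu> \<odot> \<nu>)) (Lock (Lock \<Gamma> \<mu>) \<nu>) o'"
| ctx_le_Lock_weaken:
    "\<lbrakk>ctx M \<Gamma> m; modality M \<mu> n m; modality M \<nu> n m; transformation M \<alpha> \<mu> \<nu>\<rbrakk>
      \<Longrightarrow> ctx_le M (Lock \<Gamma> \<mu>) (Lock \<Gamma> \<nu>) n"

text \<open>
  \<open>hyp M m \<mu> \<phi> \<Gamma> \<kappa>\<close> says that \<open>\<Gamma>\<close> has a hypothesis \<open>(\<mu> | \<phi>)\<close> and that \<open>\<kappa>\<close> is the
  composite of the locks to its right; \<open>m\<close> is meant to be the codomain of \<open>\<mu>\<close>.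
\<close>

primrec hyp ::
  "('o, 'm, 't, 'x) mode_theory_scheme \<Rightarrow> 'o \<Rightarrow> 'm \<Rightarrow> 'm form \<Rightarrow> 'm prectx \<Rightarrow> 'm \<Rightarrow> bool" where
  "hyp M m \<mu> \<phi> Emp \<kappa> \<longleftrightarrow> False"
| "hyp M m \<mu> \<phi> (Ext \<Gamma> \<nu> \<psi>) \<kappa> \<longleftrightarrow> (\<nu> = \<mu> \<and> \<psi> = \<phi> \<and> \<kappa> = \<one>\<^bsub>M\<^esub> m) \<or> hyp M m \<mu> \<phi> \<Gamma> \<kappa>"
| "hyp M m \<mu> \<phi> (Lock \<Gamma> \<nu>) \<kappa> \<longleftrightarrow> (\<exists>\<theta>. hyp M m \<mu> \<phi> \<Gamma> \<theta> \<and> \<kappa> = \<theta> \<odot>\<^bsub>M\<^esub> \<nu>)"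

text \<open>Rule \<open>var\<close> splits a context around a hypothesis, whereas the recursive
  \<open>hyp\<close> follows the shape of the context, which suits induction over
  \<open>ctx_le\<close>. This equivalence translates between the two.\<close>

lemma hyp_iff_cat:
  "hyp M m \<mu> \<phi> \<Gamma> \<kappa> \<longleftrightarrow> (\<exists>\<Gamma>' \<Delta>. \<Gamma> = cat (Ext \<Gamma>' \<mu> \<phi>) \<Delta> \<and> \<kappa> = locks M m \<Delta>)"
proof
  show "hyp M m \<mu> \<phi> \<Gamma> \<kappa> \<Longrightarrow> \<exists>\<Gamma>' \<Delta>. \<Gamma> = cat (Ext \<Gamma>' \<mu> \<phi>) \<Delta> \<and> \<kappa> = locks M m \<Delta>"
  proof (induction \<Gamma> arbitrary: \<kappa>)
    case Emp
    then show ?case by simp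
  next
    case (Ext \<Gamma> \<nu> \<psi>)
    then consider "\<nu> = \<mu>" "\<psi> = \<phi>" "\<kappa> = locks M m Emp" | "hyp M m \<mu> \<phi> \<Gamma> \<kappa>"
      by auto
    then show ?case
    proof cases
      case 1
      then show ?thesis by (metis cat.simps(1))
    next
      case 2
      then show ?thesis using Ext.IH by (metis cat.simps(2) locks.simps(2))
    qed
  next
    case (Lock \<Gamma> \<nu>)
    then show ?case by (metis hyp.simps(3) cat.simps(3) locks.simps(3))
  qed
next
  have "hyp M m \<mu> \<phi> (cat (Ext \<Gamma>' \<mu> \<phi>) \<Delta>) (locks M m \<Delta>)" for \<Gamma>' \<Delta>
    by (induction \<Delta>) auto
  then show "\<exists>\<Gamma>' \<Delta>. \<Gamma> = cat (Ext \<Gamma>' \<mu> \<phi>) \<Delta> \<and> \<kappa> = locks M m \<Delta> \<Longrightarrow> hyp M m \<mu> \<phi> \<Gamma> \<kappa>"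
    by blast
qed

lemma modality_unique:
  "\<lbrakk>modality M \<mu> n m; modality M \<mu> n' m'\<rbrakk> \<Longrightarrow> n' = n \<and> m' = m"
  by (simp add: modality_def)

inductive_cases ctx_ExtE: "ctx M (Ext \<Gamma> \<mu> \<phi>) m"
inductive_cases ctx_LockE: "ctx M (Lock \<Gamma> \<mu>) n"

context strict_two_category
begin

lemma ctx_mode: "ctx M \<Gamma> m \<Longrightarrow> m \<in> modes M"
  by (induction rule: ctx.induct) (auto dest: modality_modes)

lemma ctx_le_ctx: "ctx_le M \<Gamma> \<Delta> m \<Longrightarrow> ctx M \<Gamma> m \<and> ctx M \<Delta> m"
  by (induction rule: ctx_le.induct)
    (blast intro: ctx.intros one_modality comp1_modality dest: ctx_mode)+

text \<open>Both directions are proved together because \<open>ctx_le\<close> has no symmetry rule: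
  symmetry of \<open>ctx_eq\<close> swaps the conjuncts, and each lock equation is covered by a pair
  of opposite \<open>ctx_le\<close> rules.\<close>

lemma ctx_eq_imp_ctx_le: "ctx_eq M \<Gamma> \<Delta> m \<Longrightarrow> ctx_le M \<Gamma> \<Delta> m \<and> ctx_le M \<Delta> \<Gamma> m"
proof (induction rule: ctx_eq.induct)
  case (ctx_eq_trans \<Gamma> \<Delta> m \<Theta>)
  then show ?case by (meson ctx_le_trans)
qed (simp_all add: ctx_le_refl ctx_le_Lock_oneD ctx_le_Lock_oneI ctx_le_Lock_compD
    ctx_le_Lock_compI, (meson ctx_le_Ext ctx_le_Lock)+)

lemma derivable_ctx: "derivable M \<Gamma> \<phi> m \<Longrightarrow> ctx M \<Gamma> m"
proof (induction rule: derivable.induct)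
  case (conv \<Gamma> \<Delta> m \<phi>)
  then show ?case using ctx_eq_imp_ctx_le ctx_le_ctx by blast
next
  \<comment> \<open>treated before \<open>ModI\<close>, whose \<open>show\<close> would otherwise solve this goal\<close>
  case (ImpE \<mu> n m \<Gamma> \<phi> \<psi>)
  then show ?case by blast
next
  case (ModI \<mu> n m \<Gamma> \<phi>)
  \<comment> \<open>Inverting \<open>Lock\<close> yields \<open>ctx\<close> at some target of
    \<open>\<mu>\<close>, which must be \<open>m\<close> because \<open>tgt M\<close> is a
    function.\<close>
  from ModI.IH show ?case
    by (rule ctx_LockE) (use ModI.hyps(1) in \<open>auto simp: modality_def\<close>)
qed (auto elim: ctx_ExtE)

text \<open>A hypothesis sits at the codomain of its modality, and each lock to its right is
  precomposed. This typing of \<open>\<kappa>\<close> licenses the unit, associativity and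
  whiskering laws in \<open>ctx_le_hyp\<close>.\<close>

lemma hyp_modality:
  assumes "ctx M \<Gamma> n" and "modality M \<mu> n' m" and "hyp M m \<mu> \<phi> \<Gamma> \<kappa>"
  shows "modality M \<kappa> n m"
  using assms
proof (induction arbitrary: \<kappa> rule: ctx.induct)
  case (ctx_Ext \<Gamma> m' \<nu> n \<psi>)
  then show ?case
    by (metis hyp.simps(2) modality_unique modality_modes one_modality)
next
  case (ctx_Lock \<Gamma> m' \<nu> n)
  then show ?case by (auto intro: comp1_modality)
qed simp

text \<open>The lock equations leave \<open>\<kappa>\<close> unchanged by the unit and associativity
  laws, so identity 2-cells serve; transitivity composes vertically. Only \<open>ctx_le_Lock\<close>
  and \<open>ctx_le_Lock_weaken\<close> whisker, on opposite sides.\<close>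

lemma ctx_le_hyp:
  assumes "ctx_le M \<Gamma> \<Gamma>' n" and "modality M \<mu> n' m" and "hyp M m \<mu> \<phi> \<Gamma> \<kappa>"
  shows "\<exists>\<kappa>' \<alpha>. hyp M m \<mu> \<phi> \<Gamma>' \<kappa>' \<and> transformation M \<alpha> \<kappa> \<kappa>'"
  using assms
proof (induction arbitrary: \<kappa> rule: ctx_le.induct)
  case (ctx_le_refl \<Gamma> n)
  then show ?case by (blast intro: one2_transformation hyp_modality)
next
  case (ctx_le_trans \<Gamma> \<Delta> n \<Theta>)
  then show ?case by (meson vcomp_transformation)
next
  case (ctx_le_Ext \<Gamma> \<Delta> n \<nu> o' \<psi>)
  \<comment> \<open>For the last hypothesis both composites are \<open>\<one> m\<close>, related by
    an identity 2-cell; earlier hypotheses fall to the induction hypothesis.\<close>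
  then show ?case
    by (metis hyp.simps(2) modality_modes one_modality one2_transformation)
next
  case (ctx_le_Lock \<Gamma> \<Delta> n \<nu> o')
  then obtain \<theta> where l: "hyp M m \<mu> \<phi> \<Gamma> \<theta>" "\<kappa> = \<theta> \<odot> \<nu>" by auto
  with ctx_le_Lock obtain \<kappa>' \<alpha>
    where "hyp M m \<mu> \<phi> \<Delta> \<kappa>'" "transformation M \<alpha> \<theta> \<kappa>'" by blast
  moreover have "modality M \<theta> n m"
    using ctx_le_Lock l ctx_le_ctx hyp_modality by blast
  \<comment> \<open>Right whiskering: the shared lock \<open>\<nu>\<close> stands to the right of
    the part that changes.\<close>
  ultimately have "hyp M m \<mu> \<phi> (Lock \<Delta> \<nu>) (\<kappa>' \<odot> \<nu>)"
    "transformation M (\<alpha> \<star> one2 M \<nu>) \<kappa> (\<kappa>' \<odot> \<nu>)"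
    using l ctx_le_Lock.hyps by (auto intro: hcomp_transformation one2_transformation)
  then show ?case by blast
next
  case (ctx_le_Lock_oneD \<Gamma> n)
  then obtain \<theta> where l: "hyp M m \<mu> \<phi> \<Gamma> \<theta>" "\<kappa> = \<theta> \<odot> \<one> n" by auto
  then have "modality M \<theta> n m" using ctx_le_Lock_oneD hyp_modality by blast
  with l show ?case by (metis comp1_one_right one2_transformation)
next
  case (ctx_le_Lock_oneI \<Gamma> n)
  then have "modality M \<kappa> n m" using hyp_modality by blast
  with ctx_le_Lock_oneI show ?case by (metis hyp.simps(3) comp1_one_right one2_transformation)
next
  case (ctx_le_Lock_compI \<Gamma> n \<nu> o' \<xi> p)
  then obtain \<theta> where l: "hyp M m \<mu> \<phi> \<Gamma> \<theta>" "\<kappa> = \<theta> \<odot> \<nu> \<odot> \<xi>" by auto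
  then have m: "modality M \<theta> n m" using ctx_le_Lock_compI hyp_modality by blast
  then have "\<kappa> = \<theta> \<odot> (\<nu> \<odot> \<xi>)" using l ctx_le_Lock_compI comp1_assoc by blast
  moreover have "modality M \<kappa> p m" using l m ctx_le_Lock_compI comp1_modality by blast
  then have "transformation M (one2 M \<kappa>) \<kappa> \<kappa>" by (rule one2_transformation)
  ultimately show ?case using l(1) by auto
next
  case (ctx_le_Lock_compD \<Gamma> n \<nu> o' \<xi> p)
  then obtain \<theta> where l: "hyp M m \<mu> \<phi> \<Gamma> \<theta>" "\<kappa> = \<theta> \<odot> (\<nu> \<odot> \<xi>)" by auto
  then have m: "modality M \<theta> n m" using ctx_le_Lock_compD hyp_modality by blast
  then have "\<kappa> = \<theta> \<odot> \<nu> \<odot> \<xi>" using l ctx_le_Lock_compD comp1_assoc by metis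
  moreover have "modality M \<kappa> p m" using l m ctx_le_Lock_compD comp1_modality by blast
  then have "transformation M (one2 M \<kappa>) \<kappa> \<kappa>" by (rule one2_transformation)
  ultimately show ?case using l(1) by auto
next
  case (ctx_le_Lock_weaken \<Gamma> n \<nu> o' \<xi> \<alpha>)
  then obtain \<theta> where l: "hyp M m \<mu> \<phi> \<Gamma> \<theta>" "\<kappa> = \<theta> \<odot> \<nu>" by auto
  then have m: "modality M \<theta> n m" using ctx_le_Lock_weaken hyp_modality by blast
  \<comment> \<open>Left whiskering: \<open>\<theta>\<close> collects the locks between the
    hypothesis and the weakened lock.\<close>
  then have "transformation M (one2 M \<theta> \<star> \<alpha>) \<kappa> (\<theta> \<odot> \<xi>)"
    using l ctx_le_Lock_weaken by (blast intro: hcomp_transformation one2_transformation)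
  with l(1) show ?case by auto
qed

text \<open>The larger context is generalised in the induction because premises may live in extended
  or locked contexts; \<open>ctx_le_Ext\<close> and \<open>ctx_le_Lock\<close> carry the order
  there.\<close>

lemma derivable_ctx_le:
  assumes "derivable M \<Gamma> \<phi> m" and "ctx_le M \<Gamma> \<Gamma>' m"
  shows "derivable M \<Gamma>' \<phi> m"
  using assms
proof (induction arbitrary: \<Gamma>' rule: derivable.induct)
  case (conv \<Gamma> \<Delta> m \<phi>)
  \<comment> \<open>The identification of contexts is absorbed by transitivity, since the order
    contains \<open>ctx_eq\<close>.\<close>
  then show ?case by (meson ctx_eq_imp_ctx_le ctx_le_trans)
next
  case (var \<Gamma> \<mu> \<phi> \<Delta> n m \<alpha>)
  have "hyp M m \<mu> \<phi> (cat (Ext \<Gamma> \<mu> \<phi>) \<Delta>) (locks M m \<Delta>)"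
    unfolding hyp_iff_cat by blast
  with var obtain \<kappa> \<beta>
    where "hyp M m \<mu> \<phi> \<Gamma>' \<kappa>" and \<beta>: "transformation M \<beta> (locks M m \<Delta>) \<kappa>"
    by (meson ctx_le_hyp)
  then obtain \<Gamma>'' \<Delta>' where eq: "\<Gamma>' = cat (Ext \<Gamma>'' \<mu> \<phi>) \<Delta>'" "\<kappa> = locks M m \<Delta>'"
    unfolding hyp_iff_cat by blast
  moreover have "ctx M \<Gamma>' n" using var.prems ctx_le_ctx by blast
  \<comment> \<open>\<open>\<alpha>\<close> reaches the old composite of locks and
    \<open>\<beta>\<close> continues to the new one.\<close>
  moreover have "transformation M (\<beta> \<cdot> \<alpha>) \<mu> \<kappa>"
    using var.hyps \<beta> vcomp_transformation by blast
  ultimately show ?case using var.hyps derivable.var by metis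
next
  case (TopI \<Gamma> m)
  then show ?case by (meson ctx_le_ctx derivable.TopI)
next
  case (OrE \<Gamma> \<phi> \<psi> m \<chi>)
  \<comment> \<open>The side conditions of \<open>ctx_le_Ext\<close> on the modality and the formula
    come from inverting well-formedness of the extended contexts in the premises.\<close>
  have "ctx_le M (Ext \<Gamma> (\<one> m) \<phi>) (Ext \<Gamma>' (\<one> m) \<phi>) m"
    "ctx_le M (Ext \<Gamma> (\<one> m) \<psi>) (Ext \<Gamma>' (\<one> m) \<psi>) m"
    using OrE.hyps[THEN derivable_ctx] OrE.prems by (auto elim!: ctx_ExtE intro: ctx_le_Ext)
  then show ?case
    by (rule derivable.OrE[OF OrE.IH(1)[OF OrE.prems] OrE.IH(2) OrE.IH(3)])
next
  case (ImpI \<Gamma> \<mu> \<phi> \<psi> m)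
  have "ctx_le M (Ext \<Gamma> \<mu> \<phi>) (Ext \<Gamma>' \<mu> \<phi>) m"
    using ImpI.hyps(1)[THEN derivable_ctx] ImpI.prems
    by (auto elim!: ctx_ExtE intro: ctx_le_Ext)
  then show ?case by (rule derivable.ImpI[OF ImpI.IH])
next
  case (ImpE \<mu> n m \<Gamma> \<phi> \<psi>)
  then show ?case by (meson derivable.ImpE ctx_le_Lock)
next
  case (ModI \<mu> n m \<Gamma> \<phi>)
  then show ?case by (meson derivable.ModI ctx_le_Lock)
next
  case (ModE \<nu> o' n \<mu> m \<Gamma> \<phi> \<psi>)
  have "ctx_le M (Ext \<Gamma> (\<mu> \<odot> \<nu>) \<phi>) (Ext \<Gamma>' (\<mu> \<odot> \<nu>) \<phi>) m"
    using ModE.hyps(4)[THEN derivable_ctx] ModE.prems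
    by (auto elim!: ctx_ExtE intro: ctx_le_Ext)
  then have "derivable M (Ext \<Gamma>' (\<mu> \<odot> \<nu>) \<phi>) \<psi> m" by (rule ModE.IH(2))
  with ModE.IH(1)[OF ctx_le_Lock[OF ModE.prems ModE.hyps(2)]] show ?case
    by (rule derivable.ModE[OF ModE.hyps(1,2)])
next
  case (BotE \<Gamma> m \<phi>)
  from BotE.IH[OF BotE.prems] BotE.hyps(2) show ?case by (rule derivable.BotE)
next
  case (AndI \<Gamma> \<phi> m \<psi>)
  from AndI.IH(1)[OF AndI.prems] AndI.IH(2)[OF AndI.prems] show ?case by (rule derivable.AndI)
next
  case (AndE1 \<Gamma> \<phi> \<psi> m)
  from AndE1.IH[OF AndE1.prems] show ?case by (rule derivable.AndE1)
next
  case (AndE2 \<Gamma> \<phi> \<psi> m)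
  from AndE2.IH[OF AndE2.prems] show ?case by (rule derivable.AndE2)
next
  case (OrI1 \<Gamma> \<phi> m \<psi>)
  from OrI1.IH[OF OrI1.prems] OrI1.hyps(2) show ?case by (rule derivable.OrI1)
next
  case (OrI2 \<Gamma> \<psi> m \<phi>)
  from OrI2.IH[OF OrI2.prems] OrI2.hyps(2) show ?case by (rule derivable.OrI2)
qed

text \<open>The weakening step takes place at the end of the left part; recursion on
  \<open>\<Delta>\<close> carries it under each later entry by congruence.\<close>

lemma ctx_le_cat_Lock:
  assumes "modality M \<mu> n m" and "modality M \<nu> n m" and "transformation M \<alpha> \<mu> \<nu>"
    and "ctx M (cat (Lock \<Gamma> \<mu>) \<Delta>) p"
  shows "ctx_le M (cat (Lock \<Gamma> \<mu>) \<Delta>) (cat (Lock \<Gamma> \<nu>) \<Delta>) p"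
  using assms(4)
proof (induction \<Delta> arbitrary: p)
  case Emp
  then have "ctx M (Lock \<Gamma> \<mu>) p" by simp
  then show ?case
  proof (rule ctx_LockE)
    fix m'
    assume "ctx M \<Gamma> m'" "modality M \<mu> p m'"
    \<comment> \<open>A modality determines its endpoints, so \<open>p\<close> is \<open>n\<close>
      and \<open>m'\<close> is \<open>m\<close>; this also types \<open>\<nu>\<close> as
      required.\<close>
    with assms show ?thesis using ctx_le_Lock_weaken modality_unique by (metis cat.simps(1))
  qed
next
  case (Ext \<Delta> \<xi> \<psi>)
  then show ?case by (auto elim!: ctx_ExtE intro: ctx_le_Ext)
next
  case (Lock \<Delta> \<xi>)
  then show ?case by (auto elim!: ctx_LockE intro: ctx_le_Lock)
qed

end

theorem theorem2:
  fixes M :: "('o, 'm, 't) mode_theory"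
    and \<Gamma> \<Delta> :: "'m prectx" and \<mu> \<nu> :: 'm and \<alpha> :: 't and n m p :: 'o and \<phi> :: "'m form"
  assumes "strict_two_category M"
    and "modality M \<mu> n m" and "modality M \<nu> n m"
    and "transformation M \<alpha> \<mu> \<nu>"
    and "derivable M (cat (Lock \<Gamma> \<mu>) \<Delta>) \<phi> p"
  shows "derivable M (cat (Lock \<Gamma> \<nu>) \<Delta>) \<phi> p"
proof -
  interpret strict_two_category M by fact
  show ?thesis
    using assms by (meson derivable_ctx ctx_le_cat_Lock derivable_ctx_le)
qed

end
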